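(* Let $A$ be a finite set, let $X \subset A^{\mathbb{Z}}$ be a subshift of finite type, and let $\mathcal{C}$ denote the poset of irreducible components of $X$. Suppose that $\tau \colon X \to X$ is an endomorphism of $X$. Then the following hold: (i) there exists a unique map $\rho = \rho_\tau \colon \mathcal{C} \to \mathcal{C}$ such that, for every $C \in \mathcal{C}$, one has $\tau(C) \subset \rho(C)$; (ii) for every $x \in X$, one has $\rho(C_\alpha(x)) = C_\alpha(\tau(x))$ and $\rho(C_\omega(x)) = C_\omega(\tau(x))$; (iii) the map $\rho \colon \mathcal{C} \to \mathcal{C}$ is a poset endomorphism of $\mathcal{C}$. Moreover, the map $\mathrm{End}(X,\sigma) \to \mathrm{End}(\mathcal{C},\preceq)$, $\tau \mapsto \rho_\tau$, is a monoid morphism.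
   Context: $A^{\mathbb{Z}}$ carries the product topology ($A$ discrete) and the shift homeomorphism $\sigma$, $(\sigma(x))_i = x_{i+1}$. A subshift is a closed subset $X\subset A^{\mathbb{Z}}$ with $\sigma(X)=X$. It is of finite type if there are an integer $n\ge 0$ and $S\subset A^n$ such that $X$ is the set of all $x\in A^{\mathbb{Z}}$ with $(x_{i+1},\dots,x_{i+n})\in S$ for all $i\in\mathbb{Z}$. An endomorphism of $X$ is a continuous map $\tau\colon X\to X$ commuting with $\sigma$; $\mathrm{End}(X,\sigma)$ is the monoid (under composition) of endomorphisms of $X$. $\mathrm{NW}(X)$ is the set of $x\in X$ such that for every neighborhood $U$ of $x$ in $X$ there is $n\ge1$ with $U\cap\sigma^n(U)\neq\varnothing$. A subshift $Y$ is irreducible if it is non-empty and for all non-empty open $U,W\subset Y$ there is $n\ge 1$ with $U\cap\sigma^n(W)\ne\varnothing$. For a subshift of finite type $X$, there is a unique finite partition $\mathcal{C}$ of $\mathrm{NW}(X)$ into irreducible subshifts; its elements are the irreducible components of $X$. For $x\in X$, $\alpha(x)$ (resp. $\omega(x)$) is the set of limits of convergent sequences $(\sigma^{-n_k}(x))_k$ (resp. $(\sigma^{n_k}(x))_k$) with $(n_k)$ a strictly increasing sequence of non-negative integers; there are unique $C_\alpha(x),C_\omega(x)\in\mathcal{C}$ with $\alpha(x)\subset C_\alpha(x)$, $\omega(x)\subset C_\omega(x)$. $\mathcal{C}$ is partially ordered by: $C\preceq C'$ iff there is $x\in X$ with $C_\alpha(x)=C$ and $C_\omega(x)=C'$. $\mathrm{End}(\mathcal{C},\preceq)$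 is the monoid of order-preserving maps $\mathcal{C}\to\mathcal{C}$ (poset endomorphisms). *)

theory Defs
  imports "HOL-Analysis.Analysis" "HOL-Algebra.Group"
begin

section \<open>Subshifts\<close>

definition full_shift :: "'a set \<Rightarrow> (int \<Rightarrow> 'a) topology" where
  "full_shift A = product_topology (\<lambda>_. discrete_topology A) UNIV"

text \<open>The shift is defined on all functions of type \<^typ>\<open>int \<Rightarrow> 'a\<close>, where it is a bijection;
  hence \<open>\<sigma>\<^sup>-\<^sup>1\<close> is its inverse on the whole type.\<close>

definition shift :: "(int \<Rightarrow> 'a) \<Rightarrow> (int \<Rightarrow> 'a)" where
  "shift x = (\<lambda>i. x (i + 1))"

definition unshift :: "(int \<Rightarrow> 'a) \<Rightarrow> (int \<Rightarrow> 'a)" where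
  "unshift = inv_into UNIV shift"

definition subshift :: "'a set \<Rightarrow> (int \<Rightarrow> 'a) set \<Rightarrow> bool" where
  "subshift A X \<longleftrightarrow> closedin (full_shift A) X \<and> shift ` X = X"

definition subshift_of_finite_type :: "'a set \<Rightarrow> (int \<Rightarrow> 'a) set \<Rightarrow> bool" where
  "subshift_of_finite_type A X \<longleftrightarrow> subshift A X \<and>
     (\<exists>(n::nat) S. S \<subseteq> {w. set w \<subseteq> A \<and> length w = n} \<and>
        X = {x \<in> topspace (full_shift A). \<forall>i. map (\<lambda>k. x (i + int k)) [1..<Suc n] \<in> S})"

abbreviation sub_top :: "'a set \<Rightarrow> (int \<Rightarrow> 'a) set \<Rightarrow> (int \<Rightarrow> 'a) topology" where
  "sub_top A X \<equiv> subtopology (full_shift A) X"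

section \<open>Irreducible components\<close>

definition neighborhood :: "'b topology \<Rightarrow> 'b \<Rightarrow> 'b set \<Rightarrow> bool" where
  "neighborhood T x U \<longleftrightarrow> U \<subseteq> topspace T \<and> (\<exists>V. openin T V \<and> x \<in> V \<and> V \<subseteq> U)"

definition NW :: "'a set \<Rightarrow> (int \<Rightarrow> 'a) set \<Rightarrow> (int \<Rightarrow> 'a) set" where
  "NW A X = {x \<in> X. \<forall>U. neighborhood (sub_top A X) x U \<longrightarrow>
                        (\<exists>n\<ge>1. U \<inter> (shift ^^ n) ` U \<noteq> {})}"

definition irreducible_subshift :: "'a set \<Rightarrow> (int \<Rightarrow> 'a) set \<Rightarrow> bool" where
  "irreducible_subshift A Y \<longleftrightarrow> subshift A Y \<and> Y \<noteq> {} \<and>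
     (\<forall>U W. openin (sub_top A Y) U \<and> U \<noteq> {} \<and> openin (sub_top A Y) W \<and> W \<noteq> {} \<longrightarrow>
            (\<exists>n\<ge>1. U \<inter> (shift ^^ n) ` W \<noteq> {}))"

definition irr_components :: "'a set \<Rightarrow> (int \<Rightarrow> 'a) set \<Rightarrow> (int \<Rightarrow> 'a) set set" where
  "irr_components A X =
     (THE P. finite P \<and> partition_on (NW A X) P \<and> (\<forall>C\<in>P. irreducible_subshift A C))"

definition alpha_limit :: "'a set \<Rightarrow> (int \<Rightarrow> 'a) set \<Rightarrow> (int \<Rightarrow> 'a) \<Rightarrow> (int \<Rightarrow> 'a) set" where
  "alpha_limit A X x =
     {y. \<exists>n::nat \<Rightarrow> nat. strict_mono n \<and>
           limitin (sub_top A X) (\<lambda>k. (unshift ^^ n k) x) y sequentially}"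

definition omega_limit :: "'a set \<Rightarrow> (int \<Rightarrow> 'a) set \<Rightarrow> (int \<Rightarrow> 'a) \<Rightarrow> (int \<Rightarrow> 'a) set" where
  "omega_limit A X x =
     {y. \<exists>n::nat \<Rightarrow> nat. strict_mono n \<and>
           limitin (sub_top A X) (\<lambda>k. (shift ^^ n k) x) y sequentially}"

definition C_alpha :: "'a set \<Rightarrow> (int \<Rightarrow> 'a) set \<Rightarrow> (int \<Rightarrow> 'a) \<Rightarrow> (int \<Rightarrow> 'a) set" where
  "C_alpha A X x = (THE C. C \<in> irr_components A X \<and> alpha_limit A X x \<subseteq> C)"

definition C_omega :: "'a set \<Rightarrow> (int \<Rightarrow> 'a) set \<Rightarrow> (int \<Rightarrow> 'a) \<Rightarrow> (int \<Rightarrow> 'a) set" where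
  "C_omega A X x = (THE C. C \<in> irr_components A X \<and> omega_limit A X x \<subseteq> C)"

definition comp_le ::
    "'a set \<Rightarrow> (int \<Rightarrow> 'a) set \<Rightarrow> (int \<Rightarrow> 'a) set \<Rightarrow> (int \<Rightarrow> 'a) set \<Rightarrow> bool" where
  "comp_le A X C C' \<longleftrightarrow> (\<exists>x\<in>X. C_alpha A X x = C \<and> C_omega A X x = C')"

section \<open>Endomorphism monoids\<close>

text \<open>Maps between carriers are represented by extensional functions, so that equality of
  functions is equality of maps.\<close>

definition endomorphism :: "'a set \<Rightarrow> (int \<Rightarrow> 'a) set \<Rightarrow> ((int \<Rightarrow> 'a) \<Rightarrow> (int \<Rightarrow> 'a)) \<Rightarrow> bool" where
  "endomorphism A X \<tau> \<longleftrightarrow> \<tau> \<in> X \<rightarrow>\<^sub>E X \<and> continuous_map (sub_top A X) (sub_top A X) \<tau> \<and>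
     (\<forall>x\<in>X. \<tau> (shift x) = shift (\<tau> x))"

definition End_shift :: "'a set \<Rightarrow> (int \<Rightarrow> 'a) set \<Rightarrow> ((int \<Rightarrow> 'a) \<Rightarrow> (int \<Rightarrow> 'a)) monoid" where
  "End_shift A X =
     \<lparr>carrier = {\<tau>. endomorphism A X \<tau>}, mult = compose X, one = restrict id X\<rparr>"

definition poset_endomorphism :: "'b set \<Rightarrow> ('b \<Rightarrow> 'b \<Rightarrow> bool) \<Rightarrow> ('b \<Rightarrow> 'b) \<Rightarrow> bool" where
  "poset_endomorphism P R f \<longleftrightarrow> f \<in> P \<rightarrow>\<^sub>E P \<and> monotone_on P R R f"

definition End_poset :: "'b set \<Rightarrow> ('b \<Rightarrow> 'b \<Rightarrow> bool) \<Rightarrow> ('b \<Rightarrow> 'b) monoid" where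
  "End_poset P R =
     \<lparr>carrier = {f. poset_endomorphism P R f}, mult = compose P, one = restrict id P\<rparr>"

text \<open>The library's \<^const>\<open>hom\<close> only asks for multiplicativity.\<close>

definition monoid_morphism :: "('b, 'm) monoid_scheme \<Rightarrow> ('c, 'n) monoid_scheme \<Rightarrow> ('b \<Rightarrow> 'c) \<Rightarrow> bool" where
  "monoid_morphism M N h \<longleftrightarrow> monoid M \<and> monoid N \<and> h \<in> hom M N \<and> h \<one>\<^bsub>M\<^esub> = \<one>\<^bsub>N\<^esub>"

definition induced_map ::
    "'a set \<Rightarrow> (int \<Rightarrow> 'a) set \<Rightarrow> ((int \<Rightarrow> 'a) \<Rightarrow> (int \<Rightarrow> 'a)) \<Rightarrow> ((int \<Rightarrow> 'a) set \<Rightarrow> (int \<Rightarrow> 'a) set) \<Rightarrow> bool" where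
  "induced_map A X \<tau> \<rho> \<longleftrightarrow>
     \<rho> \<in> irr_components A X \<rightarrow>\<^sub>E irr_components A X \<and> (\<forall>C\<in>irr_components A X. \<tau> ` C \<subseteq> \<rho> C)"

definition rho ::
    "'a set \<Rightarrow> (int \<Rightarrow> 'a) set \<Rightarrow> ((int \<Rightarrow> 'a) \<Rightarrow> (int \<Rightarrow> 'a)) \<Rightarrow> ((int \<Rightarrow> 'a) set \<Rightarrow> (int \<Rightarrow> 'a) set)" where
  "rho A X \<tau> = (THE \<rho>. induced_map A X \<tau> \<rho>)"

end

theory Submission
  imports Defs
begin

text \<open>
  If all forbidden words have length \<open>n\<close>, two points of \<open>X\<close> sharing an \<open>n\<close>-block
  can be glued along it. Hence ``block \<open>u\<close> is followed later by block \<open>v\<close> in some point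
  of \<open>X\<close>'' is a transitive relation, and the irreducible components are the sets of points
  all of whose blocks lie in one class of mutually reachable blocks. An irreducible subshift
  covered by finitely many closed shift-invariant sets lies in one of them; this gives the
  uniqueness of the decomposition and, applied to the preimages of the components under
  \<open>\<tau>\<close>, the map \<open>\<rho>\<close>. Along each half-orbit the blocks eventually stay in one class,
  so non-empty limit sets determine components, and \<open>\<tau>\<close> maps limit points of \<open>x\<close> to
  limit points of \<open>\<tau>(x)\<close>.
\<close>

section \<open>Topology of the full shift\<close>

text \<open>The cylinders over the windows from \<open>-N\<close> to \<open>N\<close>: a
  neighbourhood base of \<open>x\<close>, through which openness and convergence are handled
  below.\<close>

definition agree :: "nat \<Rightarrow> (int \<Rightarrow> 'a) \<Rightarrow> (int \<Rightarrow> 'a) \<Rightarrow> bool" where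
  "agree N x y \<longleftrightarrow> (\<forall>i. \<bar>i\<bar> \<le> int N \<longrightarrow> x i = y i)"

text \<open>The action of all integers, so that powers of the shift and of its inverse obey one
  formula.\<close>

definition translate :: "int \<Rightarrow> (int \<Rightarrow> 'a) \<Rightarrow> (int \<Rightarrow> 'a)" where
  "translate p x = (\<lambda>i. x (i + p))"

lemma agree_mono: "agree N x y \<Longrightarrow> M \<le> N \<Longrightarrow> agree M x y"
  by (auto simp: agree_def)

lemma translate_translate [simp]: "translate p (translate q x) = translate (p + q) x"
  by (simp add: translate_def add.assoc)

lemma translate_0 [simp]: "translate 0 x = x"
  by (simp add: translate_def)

lemma shift_eq_translate: "shift = translate 1"
  by (simp add: fun_eq_iff shift_def translate_def)

lemma unshift_eq_translate: "unshift = translate (-1)"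
proof -
  have "inj (shift :: (int \<Rightarrow> 'a) \<Rightarrow> _)"
    by (rule inj_on_inverseI[where g = "translate (-1)"]) (simp add: shift_eq_translate)
  then have "unshift x = translate (-1) x" for x :: "int \<Rightarrow> 'a"
    unfolding unshift_def by (rule inv_f_eq) (simp add: shift_eq_translate)
  then show ?thesis by blast
qed

lemma shift_power: "(shift ^^ n) x = translate (int n) x"
  by (induction n) (simp_all add: shift_eq_translate)

lemma unshift_power: "(unshift ^^ n) x = translate (- int n) x"
  by (induction n) (simp_all add: unshift_eq_translate)

lemma topspace_full_shift: "topspace (full_shift A) = {x. range x \<subseteq> A}"
  by (auto simp: full_shift_def PiE_def extensional_def)

text \<open>A basic open set of the product restricts finitely many coordinates, and these lie in
  one window.\<close>

lemma openin_full_shift_iff: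
  "openin (full_shift A) U \<longleftrightarrow> U \<subseteq> topspace (full_shift A) \<and>
     (\<forall>x\<in>U. \<exists>N. \<forall>y\<in>topspace (full_shift A). agree N x y \<longrightarrow> y \<in> U)"
proof (intro iffI conjI ballI)
  assume "openin (full_shift A) U"
  then show "U \<subseteq> topspace (full_shift A)" by (rule openin_subset)
next
  fix x assume "openin (full_shift A) U" "x \<in> U"
  then obtain W where W: "finite {i. W i \<noteq> A}" "x \<in> Pi\<^sub>E UNIV W" "Pi\<^sub>E UNIV W \<subseteq> U"
    unfolding full_shift_def openin_product_topology_alt by auto
  \<comment> \<open>The largest absolute value of a restricted coordinate; the inserted
    \<open>0\<close> covers the case that there is none.\<close>
  define N where "N = Max (insert 0 ((\<lambda>i. nat \<bar>i\<bar>) ` {i. W i \<noteq> A}))"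
  have N: "\<bar>i\<bar> \<le> int N" if "W i \<noteq> A" for i
  proof -
    have "nat \<bar>i\<bar> \<le> N" unfolding N_def by (rule Max_ge) (use W that in auto)
    then show ?thesis by simp
  qed
  show "\<exists>N. \<forall>y\<in>topspace (full_shift A). agree N x y \<longrightarrow> y \<in> U"
  proof (intro exI[of _ N] ballI impI)
    fix y assume y: "y \<in> topspace (full_shift A)" "agree N x y"
    have "y i \<in> W i" for i
    proof (cases "W i = A")
      case True then show ?thesis using y by (auto simp: topspace_full_shift)
    next
      case False
      then have "y i = x i" using y N by (auto simp: agree_def)
      then show ?thesis using W(2) by auto
    qed
    then show "y \<in> U" using W(3) by auto
  qed
next
  assume *: "U \<subseteq> topspace (full_shift A) \<and>
     (\<forall>x\<in>U. \<exists>N. \<forall>y\<in>topspace (full_shift A). agree N x y \<longrightarrow> y \<in> U)"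
  show "openin (full_shift A) U"
    unfolding full_shift_def openin_product_topology_alt
  proof (intro ballI)
    fix x assume x: "x \<in> U"
    with * obtain N where N: "\<And>y. y \<in> topspace (full_shift A) \<Longrightarrow> agree N x y \<Longrightarrow> y \<in> U"
      by blast
    define W where "W i = (if \<bar>i\<bar> \<le> int N then {x i} else A)" for i
    have xA: "x i \<in> A" for i using x * by (auto simp: topspace_full_shift)
    have "{i. W i \<noteq> A} \<subseteq> {- int N..int N}" by (auto simp: W_def split: if_splits)
    then have "finite {i. W i \<noteq> A}" by (rule finite_subset) simp
    moreover have "Pi\<^sub>E UNIV W \<subseteq> U"
    proof
      fix y assume y: "y \<in> Pi\<^sub>E UNIV W"
      then have y': "y i \<in> W i" for i by auto
      have "range y \<subseteq> A"
      proof clarify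
        fix i show "y i \<in> A" using y'[of i] xA by (auto simp: W_def split: if_splits)
      qed
      moreover have "agree N x y" unfolding agree_def
      proof clarify
        fix i assume "\<bar>i\<bar> \<le> int N" then show "x i = y i" using y'[of i] by (auto simp: W_def)
      qed
      ultimately show "y \<in> U" by (intro N) (auto simp: topspace_full_shift)
    qed
    ultimately show "\<exists>W. finite {i \<in> UNIV. W i \<noteq> topspace (discrete_topology A)} \<and>
        (\<forall>i\<in>UNIV. openin (discrete_topology A) (W i)) \<and> x \<in> Pi\<^sub>E UNIV W \<and> Pi\<^sub>E UNIV W \<subseteq> U"
      using xA by (intro exI[of _ W]) (auto simp: W_def)
  qed
qed

lemma openin_sub_top_iff:
  assumes "X \<subseteq> topspace (full_shift A)"
  shows "openin (sub_top A X) U \<longleftrightarrow> U \<subseteq> X \<and> (\<forall>x\<in>U. \<exists>N. \<forall>y\<in>X. agree N x y \<longrightarrow> y \<in> U)"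
proof
  assume "openin (sub_top A X) U"
  then obtain T where "openin (full_shift A) T" "U = T \<inter> X"
    by (auto simp: openin_subtopology)
  then show "U \<subseteq> X \<and> (\<forall>x\<in>U. \<exists>N. \<forall>y\<in>X. agree N x y \<longrightarrow> y \<in> U)"
    using assms unfolding openin_full_shift_iff by blast
next
  assume *: "U \<subseteq> X \<and> (\<forall>x\<in>U. \<exists>N. \<forall>y\<in>X. agree N x y \<longrightarrow> y \<in> U)"
  \<comment> \<open>The union of those cylinders of the full shift, centred at points of
    \<open>U\<close>, whose trace on \<open>X\<close> lies in \<open>U\<close>.\<close>
  define T where
    "T = {z \<in> topspace (full_shift A). \<exists>x\<in>U. \<exists>N. agree N x z \<and> (\<forall>y\<in>X. agree N x y \<longrightarrow> y \<in> U)}"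
  have "openin (full_shift A) T"
    unfolding openin_full_shift_iff
  proof (intro conjI ballI)
    show "T \<subseteq> topspace (full_shift A)" by (auto simp: T_def)
    fix z assume "z \<in> T"
    then obtain x N where x: "x \<in> U" "agree N x z" "\<forall>y\<in>X. agree N x y \<longrightarrow> y \<in> U"
      by (auto simp: T_def)
    have "agree N x y" if "agree N z y" for y using that x(2) by (auto simp: agree_def)
    then show "\<exists>N. \<forall>y\<in>topspace (full_shift A). agree N z y \<longrightarrow> y \<in> T"
      using x unfolding T_def by blast
  qed
  moreover have "U = T \<inter> X"
  proof
    show "U \<subseteq> T \<inter> X"
    proof
      fix x assume x: "x \<in> U"
      with * obtain N where "\<forall>y\<in>X. agree N x y \<longrightarrow> y \<in> U" by blast
      moreover have "agree N x x" by (simp add: agree_def)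
      ultimately show "x \<in> T \<inter> X" using x * assms unfolding T_def by blast
    qed
  qed (auto simp: T_def)
  ultimately show "openin (sub_top A X) U" by (auto simp: openin_subtopology)
qed

lemma limitin_sub_top_iff:
  assumes "X \<subseteq> topspace (full_shift A)" and f: "\<And>k. f k \<in> X"
  shows "limitin (sub_top A X) f y sequentially \<longleftrightarrow>
    y \<in> X \<and> (\<forall>N. \<forall>\<^sub>F k in sequentially. agree N y (f k))"
proof
  assume L: "limitin (sub_top A X) f y sequentially"
  then have y: "y \<in> X" by (auto simp: limitin_def)
  have "\<forall>\<^sub>F k in sequentially. agree N y (f k)" for N
  proof -
    have "openin (sub_top A X) {z \<in> X. agree N y z}"
      unfolding openin_sub_top_iff[OF assms(1)] by (force simp: agree_def)
    moreover have "y \<in> {z \<in> X. agree N y z}" using y by (simp add: agree_def)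
    ultimately have "\<forall>\<^sub>F k in sequentially. f k \<in> {z \<in> X. agree N y z}"
      using L unfolding limitin_def by blast
    then show ?thesis by eventually_elim auto
  qed
  with y show "y \<in> X \<and> (\<forall>N. \<forall>\<^sub>F k in sequentially. agree N y (f k))" by blast
next
  assume *: "y \<in> X \<and> (\<forall>N. \<forall>\<^sub>F k in sequentially. agree N y (f k))"
  show "limitin (sub_top A X) f y sequentially"
    unfolding limitin_def
  proof (intro conjI allI impI)
    show "y \<in> topspace (sub_top A X)" using * assms by auto
    fix U assume "openin (sub_top A X) U \<and> y \<in> U"
    then obtain N where N: "\<And>z. z \<in> X \<Longrightarrow> agree N y z \<Longrightarrow> z \<in> U"
      unfolding openin_sub_top_iff[OF assms(1)] by blast
    from * have "\<forall>\<^sub>F k in sequentially. agree N y (f k)" by blast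
    then show "\<forall>\<^sub>F k in sequentially. f k \<in> U" by eventually_elim (use N f in auto)
  qed
qed

text \<open>The full shift is compact by Tychonoff, since \<open>A\<close> is finite, and metrizable
  as a countable product of discrete spaces; for metric spaces compactness is sequential
  compactness.\<close>

lemma closed_full_shift_sequentially_compact:
  fixes f :: "nat \<Rightarrow> int \<Rightarrow> 'a"
  assumes "finite A" and X: "closedin (full_shift A) X" and f: "\<And>k. f k \<in> X"
  obtains y n where "strict_mono n" "limitin (sub_top A X) (f \<circ> n) y sequentially"
proof -
  have "compact_space (full_shift A)"
    unfolding full_shift_def
    by (intro compact_space_product_topology[THEN iffD2] disjI2 ballI)
      (use assms in \<open>simp add: compact_space_discrete_topology\<close>)
  then have comp: "compactin (full_shift A) X" using X by (rule closedin_compact_space)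
  have "metrizable_space (full_shift A)"
    unfolding full_shift_def
    by (intro metrizable_space_product_topology[THEN iffD2] disjI2 conjI)
      (auto simp: metrizable_space_discrete_topology)
  then obtain M d where M: "Metric_space M d" "full_shift A = Metric_space.mtopology M d"
    unfolding metrizable_space_def by blast
  interpret Metric_space M d by fact
  from comp have "\<forall>\<sigma>::nat \<Rightarrow> _. range \<sigma> \<subseteq> X \<longrightarrow>
      (\<exists>l r. l \<in> X \<and> strict_mono r \<and> limitin mtopology (\<sigma> \<circ> r) l sequentially)"
    unfolding M(2) compactin_sequentially by blast
  with f obtain l r where l: "l \<in> X" "strict_mono r" "limitin mtopology (f \<circ> r) l sequentially"
    by blast
  then have "limitin (sub_top A X) (f \<circ> r) l sequentially"
    using f by (auto simp: limitin_subtopology M(2))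
  with l that show ?thesis by blast
qed

section \<open>Subshifts and irreducibility\<close>

lemma subshift_subset: "subshift A X \<Longrightarrow> X \<subseteq> topspace (full_shift A)"
  by (auto simp: subshift_def dest: closedin_subset)

lemma subshift_translate_iff:
  assumes "subshift A X"
  shows "translate p x \<in> X \<longleftrightarrow> x \<in> X"
proof -
  have img: "shift ` X = X" using assms by (simp add: subshift_def)
  have up: "translate 1 x \<in> X" if "x \<in> X" for x
    using img that by (auto simp: shift_eq_translate)
  have down: "translate (-1) x \<in> X" if "x \<in> X" for x
  proof -
    from img that obtain y where "y \<in> X" "x = translate 1 y" by (auto simp: shift_eq_translate)
    then show ?thesis by simp
  qed
  have *: "translate p x \<in> X" if "x \<in> X" for p x
  proof (induction p rule: int_induct[where k = 0])
    case base then show ?case using that by simp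
  next
    case (step1 i) then show ?case using up[of "translate i x"] by (simp add: add.commute)
  next
    case (step2 i) then show ?case using down[of "translate i x"] by (simp add: add.commute)
  qed
  show ?thesis
    using *[of x p] *[of "translate p x" "-p"] by auto
qed

text \<open>The last assumption says that the complement in \<open>X\<close> contains a cylinder
  around each of its points. Closedness in \<open>X\<close> passes to the full shift because
  \<open>X\<close> is closed there.\<close>

lemma subshiftI:
  assumes X: "subshift A X" and Y: "Y \<subseteq> X"
    and inv: "\<And>p x. x \<in> Y \<Longrightarrow> translate p x \<in> Y"
    and closed: "\<And>x. x \<in> X \<Longrightarrow> (\<And>N. \<exists>y\<in>Y. agree N x y) \<Longrightarrow> x \<in> Y"
  shows "subshift A Y"
  unfolding subshift_def
proof
  note XA = subshift_subset[OF X]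
  have "openin (sub_top A X) (X - Y)"
    unfolding openin_sub_top_iff[OF XA] using closed by blast
  then have "closedin (sub_top A X) Y"
    using Y XA by (auto simp: closedin_def Int_absorb1)
  then show "closedin (full_shift A) Y"
    using X by (metis closedin_trans_full subshift_def)
  show "shift ` Y = Y"
  proof
    show "shift ` Y \<subseteq> Y" using inv by (auto simp: shift_eq_translate)
    show "Y \<subseteq> shift ` Y"
    proof
      fix x assume "x \<in> Y"
      then have "translate (-1) x \<in> Y" by (rule inv)
      then show "x \<in> shift ` Y" by (rule rev_image_eqI) (simp add: shift_eq_translate)
    qed
  qed
qed

lemma irreducible_subshiftE:
  assumes "irreducible_subshift A Y"
    and "openin (sub_top A Y) U" "openin (sub_top A Y) W" "U \<noteq> {}" "W \<noteq> {}"
  obtains n z where "z \<in> W" "translate (int n) z \<in> U"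
proof -
  from assms obtain n where "U \<inter> (shift ^^ n) ` W \<noteq> {}"
    unfolding irreducible_subshift_def by meson
  then obtain z where "z \<in> W" "(shift ^^ n) z \<in> U" by auto
  then show ?thesis using that by (simp add: shift_power)
qed

lemma NW_E:
  assumes "x \<in> NW A X" and "neighborhood (sub_top A X) x U"
  obtains m z where "m \<ge> 1" "z \<in> U" "translate (int m) z \<in> U"
proof -
  from assms obtain m where "m \<ge> 1" "U \<inter> (shift ^^ m) ` U \<noteq> {}"
    unfolding NW_def mem_Collect_eq by meson
  moreover from this obtain z where "z \<in> U" "(shift ^^ m) z \<in> U" by auto
  ultimately show ?thesis using that by (simp add: shift_power)
qed

text \<open>The covering sets are only required to be relatively closed in \<^term>\<open>C\<close>, so that
  preimages of subshifts under endomorphisms are allowed.\<close>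

lemma irreducible_subset_of_finite_cover:
  assumes C: "irreducible_subshift A C"
    and "finite I"
    and "C \<subseteq> (\<Union>i\<in>I. D i)"
    and "\<And>i. i \<in> I \<Longrightarrow> closedin (sub_top A C) (C \<inter> D i)"
    and "\<And>i x p. i \<in> I \<Longrightarrow> x \<in> C \<Longrightarrow> translate p x \<in> D i \<Longrightarrow> x \<in> D i"
  shows "\<exists>i\<in>I. C \<subseteq> D i"
proof -
  have sub: "subshift A C" and "C \<noteq> {}" using C by (auto simp: irreducible_subshift_def)
  have ts: "topspace (sub_top A C) = C" using subshift_subset[OF sub] by auto
  have "\<lbrakk>\<forall>i\<in>I. \<not> C \<subseteq> D i; \<forall>i\<in>I. closedin (sub_top A C) (C \<inter> D i);
      \<forall>i\<in>I. \<forall>x\<in>C. \<forall>p. translate p x \<in> D i \<longrightarrow> x \<in> D i\<rbrakk> \<Longrightarrow> \<not> C \<subseteq> (\<Union>i\<in>I. D i)"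
    using \<open>finite I\<close>
  proof (induction I rule: finite_induct)
    case empty then show ?case using \<open>C \<noteq> {}\<close> by simp
  next
    case (insert i I)
    let ?E = "\<Union>j\<in>I. D j"
    have "closedin (sub_top A C) (\<Union>j\<in>I. C \<inter> D j)"
      by (rule closedin_Union) (use insert in auto)
    moreover have "C - (\<Union>j\<in>I. C \<inter> D j) = C - ?E" by blast
    ultimately have W: "openin (sub_top A C) (C - ?E)"
      unfolding closedin_def ts by simp
    have U: "openin (sub_top A C) (C - D i)"
      using insert.prems(2) unfolding closedin_def ts by (simp add: Diff_Int)
    have "C - D i \<noteq> {}" "C - ?E \<noteq> {}" using insert by auto
    with U W obtain n z where z: "z \<in> C - ?E" "translate (int n) z \<in> C - D i"
      by (rule irreducible_subshiftE[OF C])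
    \<comment> \<open>By invariance an orbit starting outside \<open>?E\<close> never enters it, so
      the later point avoids \<open>D i\<close> and \<open>?E\<close> at once.\<close>
    have "translate (int n) z \<notin> ?E" using z insert.prems(3) by blast
    then show ?case using z by auto
  qed
  then show ?thesis using assms by blast
qed

section \<open>Uniqueness of decompositions into irreducible subshifts\<close>

lemma irreducible_subset_of_partition:
  assumes C: "irreducible_subshift A C" and "finite P" and "C \<subseteq> \<Union>P"
    and P: "\<And>D. D \<in> P \<Longrightarrow> subshift A D"
  shows "\<exists>D\<in>P. C \<subseteq> D"
proof (rule irreducible_subset_of_finite_cover[OF C \<open>finite P\<close>])
  fix D assume D: "D \<in> P"
  show "closedin (sub_top A C) (C \<inter> D)"
    using P[OF D] by (auto simp: subshift_def closedin_subtopology)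
  show "x \<in> D" if "translate p x \<in> D" for x p
    using that subshift_translate_iff[OF P[OF D]] by blast
qed (use assms in auto)

text \<open>Each \<open>C\<close> in \<open>P\<close> lies in some \<open>D\<close> in
  \<open>Q\<close>, which in turn lies in some \<open>C'\<close> in \<open>P\<close>. Since
  \<open>C\<close> is non-empty and \<open>P\<close> is disjoint, \<open>C = C'\<close>, and both
  inclusions are equalities.\<close>

lemma irreducible_partition_unique:
  assumes P: "finite P" "partition_on S P" "\<And>C. C \<in> P \<Longrightarrow> irreducible_subshift A C"
    and Q: "finite Q" "partition_on S Q" "\<And>C. C \<in> Q \<Longrightarrow> irreducible_subshift A C"
  shows "P = Q"
proof -
  have half: "P \<subseteq> Q"
    if P: "finite P" "partition_on S P" "\<And>C. C \<in> P \<Longrightarrow> irreducible_subshift A C"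
      and Q: "finite Q" "partition_on S Q" "\<And>C. C \<in> Q \<Longrightarrow> irreducible_subshift A C"
    for P Q
  proof
    fix C assume C: "C \<in> P"
    have irr: "irreducible_subshift A C" by (rule P(3)[OF C])
    have "\<exists>D\<in>Q. C \<subseteq> D"
      by (rule irreducible_subset_of_partition[OF irr Q(1)])
        (use C P(2) Q in \<open>auto simp: partition_on_def irreducible_subshift_def\<close>)
    then obtain D where D: "D \<in> Q" "C \<subseteq> D" by blast
    have "\<exists>C'\<in>P. D \<subseteq> C'"
      by (rule irreducible_subset_of_partition[OF Q(3)[OF D(1)] P(1)])
        (use D(1) P Q(2) in \<open>auto simp: partition_on_def irreducible_subshift_def\<close>)
    then obtain C' where C': "C' \<in> P" "D \<subseteq> C'" by blast
    have "C \<noteq> {}" using irr by (simp add: irreducible_subshift_def)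
    moreover have "C \<subseteq> C'" using C' D by blast
    ultimately have "C \<inter> C' \<noteq> {}" by blast
    then have "C = C'" using disjointD[OF partition_onD2[OF P(2)] C C'(1)] by blast
    then show "C \<in> Q" using C' D by auto
  qed
  show ?thesis using half[OF P Q] half[OF Q P] by blast
qed

section \<open>Blocks and gluing\<close>

definition block :: "nat \<Rightarrow> (int \<Rightarrow> 'a) \<Rightarrow> int \<Rightarrow> 'a list" where
  "block n x i = map (\<lambda>k. x (i + int k)) [0..<n]"

definition glue :: "(int \<Rightarrow> 'a) \<Rightarrow> int \<Rightarrow> (int \<Rightarrow> 'a) \<Rightarrow> int \<Rightarrow> (int \<Rightarrow> 'a)" where
  "glue x i y j = (\<lambda>t. if t < i then x t else y (t - i + j))"

lemma block_eq_iff: "block n x i = block n y j \<longleftrightarrow> (\<forall>k<n. x (i + int k) = y (j + int k))"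
  by (auto simp: block_def)

lemma block_translate [simp]: "block n (translate p x) i = block n x (i + p)"
  by (simp add: block_eq_iff translate_def algebra_simps)

text \<open>On the common block both points show the same letters, so the glued point follows
  \<open>x\<close> for \<open>n\<close> letters beyond the seam.\<close>

lemma glue_left:
  assumes "block n x i = block n y j" and "t < i + int n"
  shows "glue x i y j t = x t"
proof (cases "t < i")
  case False
  then obtain k where k: "t = i + int k" by (metis linorder_not_less zle_iff_zadd)
  with assms have "x (i + int k) = y (j + int k)" by (simp add: block_eq_iff)
  then show ?thesis using k by (simp add: glue_def add.commute)
qed (simp add: glue_def)

lemma glue_right: "i \<le> t \<Longrightarrow> glue x i y j t = y (t - i + j)"
  by (simp add: glue_def)

text \<open>Isolates the consequence of finite type on which the argument rests: closure under
  gluing along a common block of length \<open>n\<close>.\<close>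

locale glued_subshift =
  fixes A :: "'a set" and X :: "(int \<Rightarrow> 'a) set" and n :: nat
  assumes finite_A: "finite A"
    and sub: "subshift A X"
    and glue_mem: "x \<in> X \<Longrightarrow> y \<in> X \<Longrightarrow> block n x i = block n y j \<Longrightarrow> glue x i y j \<in> X"

text \<open>Because of the overlap of \<open>n\<close> letters, every window of length
  \<open>n\<close> of the glued point is read entirely in \<open>x\<close> (start at most
  \<open>i\<close>) or entirely in \<open>y\<close>.\<close>

lemma finite_type_glued_subshift:
  assumes "finite A" and "subshift_of_finite_type A X"
  obtains n where "glued_subshift A X n"
proof -
  from assms(2) obtain n S where sub: "subshift A X"
    and X: "X = {x \<in> topspace (full_shift A). \<forall>i. map (\<lambda>k. x (i + int k)) [1..<Suc n] \<in> S}"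
    unfolding subshift_of_finite_type_def by blast
  \<comment> \<open>Finite type reads the words at \<open>i+1\<close> to \<open>i+n\<close>, blocks
    start at \<open>i\<close>; the offset disappears because \<open>i\<close> ranges over all
    integers.\<close>
  have "map (\<lambda>k. x (i + int k)) [1..<Suc n] = block n x (i + 1)" for x :: "int \<Rightarrow> 'a" and i
    by (rule nth_equalityI) (simp_all add: block_def algebra_simps del: upt_Suc)
  then have "X = {x \<in> topspace (full_shift A). \<forall>i. block n x (i + 1) \<in> S}"
    using X by simp
  also have "\<dots> = {x \<in> topspace (full_shift A). \<forall>i. block n x i \<in> S}"
    by (metis (no_types, lifting) diff_add_cancel)
  finally have X': "x \<in> X \<longleftrightarrow> x \<in> topspace (full_shift A) \<and> (\<forall>i. block n x i \<in> S)" for x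
    by blast
  have "glue x i y j \<in> X" if x: "x \<in> X" and y: "y \<in> X" and eq: "block n x i = block n y j"
    for x y i j
  proof -
    have "block n (glue x i y j) t \<in> S" for t
    proof (cases "t \<le> i")
      case True
      then have "block n (glue x i y j) t = block n x t"
        by (auto simp: block_eq_iff intro!: glue_left[OF eq])
      then show ?thesis using x X' by simp
    next
      case False
      then have "block n (glue x i y j) t = block n y (t - i + j)"
        by (auto simp: block_eq_iff glue_right algebra_simps)
      then show ?thesis using y X' by simp
    qed
    moreover have "glue x i y j \<in> topspace (full_shift A)"
      using x y X' by (auto simp: topspace_full_shift glue_def)
    ultimately show ?thesis using X' by blast
  qed
  then have "glued_subshift A X n" using sub assms(1) by unfold_locales
  then show ?thesis by (rule that)
qed

section \<open>Irreducible components of a subshift of finite type\<close>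

context glued_subshift
begin

text \<open>The inequality \<open>i < j\<close> is strict, so reachability is not reflexive in
  general: a block reaches itself only if it can recur.\<close>

definition reach :: "'a list \<Rightarrow> 'a list \<Rightarrow> bool" where
  "reach u v \<longleftrightarrow> (\<exists>x\<in>X. \<exists>i j. i < j \<and> block n x i = u \<and> block n x j = v)"

definition linked :: "'a list \<Rightarrow> 'a list \<Rightarrow> bool" where
  "linked u v \<longleftrightarrow> reach u v \<and> reach v u"

text \<open>Empty unless \<open>u\<close> is linked to itself; the non-empty ones turn out to be the
  irreducible components.\<close>

definition component :: "'a list \<Rightarrow> (int \<Rightarrow> 'a) set" where
  "component u = {x \<in> X. \<forall>i. linked u (block n x i)}"

lemmas XA = subshift_subset[OF sub]
lemmas translate_mem = subshift_translate_iff[OF sub]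

lemma reachI: "x \<in> X \<Longrightarrow> i < j \<Longrightarrow> reach (block n x i) (block n x j)"
  unfolding reach_def by blast

text \<open>A path joining a block of \<^term>\<open>x\<close> to a block of \<^term>\<open>y\<close> is inserted between
  the left half of \<^term>\<open>x\<close> and the right half of \<^term>\<open>y\<close>.\<close>

lemma connect:
  assumes x: "x \<in> X" and y: "y \<in> X" and r: "reach (block n x i) (block n y j)"
  obtains z p where "z \<in> X" "i < p" "\<And>t. t < i + int n \<Longrightarrow> z t = x t"
    "\<And>t. p \<le> t \<Longrightarrow> z t = y (t - p + j)"
proof -
  from r obtain q a b where q: "q \<in> X" "a < b" "block n q a = block n x i"
    "block n q b = block n y j" unfolding reach_def by blast
  define z1 where "z1 = glue x i q a"
  \<comment> \<open>The place where position \<open>b\<close> of the path \<open>q\<close> lands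
    once its position \<open>a\<close> has been moved to \<open>i\<close>.\<close>
  define p where "p = i + (b - a)"
  have z1: "z1 \<in> X" unfolding z1_def by (rule glue_mem) (use x q in auto)
  have "block n z1 p = block n q b"
    using q(2) by (auto simp: z1_def p_def block_eq_iff glue_right algebra_simps)
  then have eq: "block n z1 p = block n y j" using q by simp
  show thesis
  proof
    show "glue z1 p y j \<in> X" by (rule glue_mem[OF z1 y eq])
    show "i < p" using q by (simp add: p_def)
    show "glue z1 p y j t = x t" if "t < i + int n" for t
    proof -
      have "glue z1 p y j t = z1 t" using that q(2) by (intro glue_left[OF eq]) (simp add: p_def)
      also have "\<dots> = x t" unfolding z1_def using that q(3) by (intro glue_left) auto
      finally show ?thesis .
    qed
    show "glue z1 p y j t = y (t - p + j)" if "p \<le> t" for t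
      using that by (rule glue_right)
  qed
qed

text \<open>The two witnesses are glued along their common block \<open>v\<close>.\<close>

lemma reach_trans:
  assumes "reach u v" "reach v w"
  shows "reach u w"
proof -
  from assms obtain x i j y i' j' where x: "x \<in> X" "i < j" "block n x i = u" "block n x j = v"
    and y: "y \<in> X" "i' < j'" "block n y i' = v" "block n y j' = w"
    unfolding reach_def by blast
  have eq: "block n x j = block n y i'" using x y by simp
  let ?z = "glue x j y i'"
  have "block n ?z i = block n x i"
    unfolding block_eq_iff using x by (auto intro!: glue_left[OF eq])
  moreover have "block n ?z (j + (j' - i')) = block n y j'"
    unfolding block_eq_iff using y by (auto simp: glue_right algebra_simps)
  moreover have "?z \<in> X" using x y eq by (intro glue_mem)
  ultimately show ?thesis
    using reachI[of ?z i "j + (j' - i')"] x y by simp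
qed

lemma linked_sym: "linked u v \<Longrightarrow> linked v u"
  by (simp add: linked_def)

lemma linked_trans: "linked u v \<Longrightarrow> linked v w \<Longrightarrow> linked u w"
  unfolding linked_def by (blast intro: reach_trans)

text \<open>A return to a small cylinder around \<open>x\<close> gives a point of \<open>X\<close>
  showing the block at \<open>i + 1\<close> and, \<open>m - 1\<close> steps later, the block at
  \<open>i\<close> again.\<close>

lemma nonwandering_linked_Suc:
  assumes x: "x \<in> NW A X"
  shows "linked (block n x i) (block n x (i + 1))"
proof -
  have xX: "x \<in> X" using x by (simp add: NW_def)
  \<comment> \<open>A window containing the blocks at \<open>i\<close> and at
    \<open>i + 1\<close>.\<close>
  define N where "N = nat \<bar>i\<bar> + n + 1"
  have eqN: "block n z i = block n x i" "block n z (i + 1) = block n x (i + 1)"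
    if "agree N x z" for z
    using that by (auto simp: block_eq_iff agree_def N_def)
  define U where "U = {z \<in> X. agree N x z}"
  have "openin (sub_top A X) U"
    unfolding openin_sub_top_iff[OF XA] U_def by (force simp: agree_def)
  moreover have "x \<in> U" using xX by (simp add: U_def agree_def)
  ultimately have "neighborhood (sub_top A X) x U"
    unfolding neighborhood_def by (meson openin_subset order_refl)
  with x obtain m z where m: "m \<ge> 1" and z: "z \<in> U" "translate (int m) z \<in> U"
    by (rule NW_E)
  have eq: "block n z (i + 1) = block n x (i + 1)" "block n z (i + int m) = block n x i"
    using eqN[of z] eqN[of "translate (int m) z"] z by (auto simp: U_def)
  have fwd: "reach (block n x i) (block n x (i + 1))" by (rule reachI[OF xX]) simp
  have "reach (block n x (i + 1)) (block n x i)"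
  \<comment> \<open>For \<open>m = 1\<close> the two occurrences sit at the same position, so the
    two blocks are equal and the forward relation suffices.\<close>
  proof (cases "m = 1")
    case True
    then show ?thesis using eq fwd by simp
  next
    case False
    then have "i + 1 < i + int m" using m by simp
    then show ?thesis using reachI[of z "i + 1" "i + int m"] z eq by (simp add: U_def)
  qed
  with fwd show ?thesis by (simp add: linked_def)
qed

lemma nonwandering_linked:
  assumes x: "x \<in> NW A X"
  shows "linked (block n x i) (block n x j)"
proof -
  \<comment> \<open>Reflexivity is special to these blocks: go to the next block and back.\<close>
  have refl: "linked (block n x i) (block n x i)" for i
    using nonwandering_linked_Suc[OF x, of i] linked_sym linked_trans by blast
  have "linked (block n x i) (block n x (i + int k))" for i k
  proof (induction k)
    case 0 then show ?case using refl by simp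
  next
    case (Suc k)
    then show ?case using nonwandering_linked_Suc[OF x, of "i + int k"] linked_trans
      by (auto simp: algebra_simps)
  qed
  note up = this
  show ?thesis
  proof (cases "i \<le> j")
    case True then show ?thesis using up[of i "nat (j - i)"] by simp
  next
    case False then show ?thesis using up[of j "nat (i - j)"] linked_sym by simp
  qed
qed

text \<open>A path inside the class leads from the window of \<open>y\<close> to the window of
  \<open>x\<close>. Distinct targets give irreducibility, equal targets give non-wandering
  points.\<close>

lemma component_transitive:
  assumes x: "x \<in> component u" and y: "y \<in> component u"
  obtains z m where "z \<in> component u" "m \<ge> 1" "agree N y z" "agree N x (translate (int m) z)"
proof -
  have xX: "x \<in> X" and yX: "y \<in> X" and lx: "\<And>i. linked u (block n x i)"
    and ly: "\<And>i. linked u (block n y i)" using x y by (auto simp: component_def)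
  \<comment> \<open>Leaving \<open>y\<close> just right of its window and entering \<open>x\<close>
    at the left end of its window keeps both windows intact.\<close>
  have "reach (block n y (int N + 1)) (block n x (- int N))"
    using linked_trans[OF linked_sym[OF ly] lx] by (simp add: linked_def)
  from connect[OF yX xX this] obtain z p where
    z: "z \<in> X" "int N + 1 < p" "\<And>t. t < int N + 1 + int n \<Longrightarrow> z t = y t"
    "\<And>t. p \<le> t \<Longrightarrow> z t = x (t - p + - int N)"
    by metis
  have left: "linked u (block n z t)" if "t \<le> int N + 1" for t
  proof -
    have "block n z t = block n y t" using that z(3) by (simp add: block_eq_iff)
    then show ?thesis using ly by simp
  qed
  have right: "linked u (block n z t)" if "p \<le> t" for t
  proof -
    have "block n z t = block n x (t - p - int N)"
      using that z(4) by (simp add: block_eq_iff algebra_simps)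
    then show ?thesis using lx by simp
  qed
  \<comment> \<open>A block on the inserted path is reached from the class and reaches it again,
    hence belongs to it.\<close>
  have "linked u (block n z t)" for t
  proof (cases "t \<le> int N + 1 \<or> p \<le> t")
    case False
    then have "reach (block n z (int N + 1)) (block n z t)" "reach (block n z t) (block n z p)"
      using z(1) by (auto intro: reachI)
    moreover have "reach u (block n z (int N + 1))" "reach (block n z p) u"
      using left[of "int N + 1"] right[of p] by (auto simp: linked_def)
    ultimately show ?thesis unfolding linked_def by (blast intro: reach_trans)
  qed (use left right in auto)
  then have "z \<in> component u" using z(1) by (simp add: component_def)
  moreover have "agree N y z" using z(3) by (auto simp: agree_def)
  \<comment> \<open>Position \<open>p\<close> of \<open>z\<close> carries coordinate
    \<open>-N\<close> of \<open>x\<close>, so moving by \<open>p + N\<close> centres the window of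
    \<open>x\<close>.\<close>
  moreover have "agree N x (translate (int (nat (p + int N))) z)"
    using z(2,4) by (auto simp: agree_def translate_def)
  moreover have "nat (p + int N) \<ge> 1" using z(2) by simp
  ultimately show ?thesis using that by blast
qed

section \<open>Classes of blocks as irreducible subshifts\<close>

lemma component_subset_NW: "component u \<subseteq> NW A X"
proof
  fix x assume x: "x \<in> component u"
  have "\<exists>m\<ge>1. U \<inter> (shift ^^ m) ` U \<noteq> {}" if "neighborhood (sub_top A X) x U" for U
  proof -
    from that obtain V where V: "openin (sub_top A X) V" "x \<in> V" "V \<subseteq> U"
      by (auto simp: neighborhood_def)
    then obtain N where N: "\<And>y. y \<in> X \<Longrightarrow> agree N x y \<Longrightarrow> y \<in> V"
      unfolding openin_sub_top_iff[OF XA] by blast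
    \<comment> \<open>With both targets equal to \<open>x\<close>, transitivity becomes a return to
      \<open>U\<close>.\<close>
    obtain z m where z: "z \<in> component u" "m \<ge> 1" "agree N x z" "agree N x (translate (int m) z)"
      by (rule component_transitive[OF x x])
    then have "z \<in> X" by (simp add: component_def)
    then have "z \<in> U" "translate (int m) z \<in> U" using N z V translate_mem by blast+
    then show ?thesis using z(2) by (auto simp: shift_power intro!: exI[of _ m])
  qed
  then show "x \<in> NW A X" using x by (auto simp: NW_def component_def)
qed

lemma mem_component: "x \<in> NW A X \<Longrightarrow> x \<in> component (block n x i)"
  using nonwandering_linked by (auto simp: component_def NW_def)

lemma component_eq:
  assumes "x \<in> component u"
  shows "component u = component (block n x i)"
  using assms unfolding component_def by (blast intro: linked_trans linked_sym)

lemma components_disjoint: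
  "x \<in> component u \<Longrightarrow> x \<in> component v \<Longrightarrow> component u = component v"
  using component_eq[of x u 0] component_eq[of x v 0] by simp

text \<open>Membership of one block in the class depends on finitely many coordinates, so it
  survives limits; it is required at all positions, hence invariant.\<close>

lemma subshift_component: "subshift A (component u)"
proof (rule subshiftI[OF sub])
  show "component u \<subseteq> X" by (auto simp: component_def)
  show "translate p x \<in> component u" if "x \<in> component u" for p x
    using that by (simp add: component_def translate_mem)
  show "x \<in> component u" if x: "x \<in> X" "\<And>N. \<exists>y\<in>component u. agree N x y" for x
  proof -
    have "linked u (block n x i)" for i
    proof -
      obtain y where y: "y \<in> component u" "agree (nat \<bar>i\<bar> + n) x y" using x(2) by blast
      then have "block n x i = block n y i" by (auto simp: block_eq_iff agree_def)
      then show ?thesis using y by (simp add: component_def)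
    qed
    then show ?thesis using x by (simp add: component_def)
  qed
qed

lemma irreducible_component:
  assumes "component u \<noteq> {}"
  shows "irreducible_subshift A (component u)"
  unfolding irreducible_subshift_def
proof (intro conjI allI impI)
  show "subshift A (component u)" by (rule subshift_component)
  show "component u \<noteq> {}" by fact
  note CA = subshift_subset[OF subshift_component[of u]]
  fix U W
  assume *: "openin (sub_top A (component u)) U \<and> U \<noteq> {} \<and>
    openin (sub_top A (component u)) W \<and> W \<noteq> {}"
  then obtain x y where xy: "x \<in> U" "y \<in> W" by blast
  from * have "openin (sub_top A (component u)) U" "openin (sub_top A (component u)) W" by simp_all
  note opn = this[unfolded openin_sub_top_iff[OF CA]]
  then have Uc: "U \<subseteq> component u" "W \<subseteq> component u" by simp_all
  obtain N1 where N1: "\<And>z. z \<in> component u \<Longrightarrow> agree N1 x z \<Longrightarrow> z \<in> U"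
    using opn(1) xy(1) by meson
  obtain N2 where N2: "\<And>z. z \<in> component u \<Longrightarrow> agree N2 y z \<Longrightarrow> z \<in> W"
    using opn(2) xy(2) by meson
  have xyu: "x \<in> component u" "y \<in> component u" using xy Uc by auto
  obtain z m where z: "z \<in> component u" "m \<ge> 1" "agree (max N1 N2) y z"
    "agree (max N1 N2) x (translate (int m) z)"
    by (rule component_transitive[OF xyu])
  have "z \<in> W" using z by (intro N2) (auto intro: agree_mono)
  moreover have "translate (int m) z \<in> U"
    using z subshift_translate_iff[OF subshift_component] by (intro N1) (auto intro: agree_mono)
  ultimately show "\<exists>m\<ge>1. U \<inter> (shift ^^ m) ` W \<noteq> {}"
    using z(2) by (auto simp: shift_power intro!: exI[of _ m])
qed

section \<open>Identification of the irreducible components\<close>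

lemma finite_blocks: "finite {block n x i |x i. x \<in> X}"
proof (rule finite_subset)
  show "{block n x i |x i. x \<in> X} \<subseteq> {w. set w \<subseteq> A \<and> length w = n}"
    using XA by (fastforce simp: block_def topspace_full_shift)
qed (rule finite_lists_length_eq[OF finite_A])

text \<open>A non-empty component is indexed by any block of any of its points, and only finitely
  many blocks occur in \<open>X\<close>.\<close>

lemma finite_components: "finite {component u |u. component u \<noteq> {}}"
proof (rule finite_subset)
  show "{component u |u. component u \<noteq> {}} \<subseteq> component ` {block n x i |x i. x \<in> X}"
  proof
    fix C assume "C \<in> {component u |u. component u \<noteq> {}}"
    then obtain u x where C: "C = component u" and x: "x \<in> component u" by blast
    have "component u = component (block n x 0)" by (rule component_eq[OF x])
    moreover have "x \<in> X" using x by (simp add: component_def)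
    ultimately show "C \<in> component ` {block n x i |x i. x \<in> X}" unfolding C by blast
  qed
qed (intro finite_imageI finite_blocks)

text \<open>The definite description is resolved by showing that these sets form an admissible
  partition and invoking uniqueness.\<close>

lemma irr_components_eq: "irr_components A X = {component u |u. component u \<noteq> {}}"
  (is "_ = ?P")
proof -
  have fin: "finite ?P" by (rule finite_components)
  have part: "partition_on (NW A X) ?P"
  proof (rule partition_onI)
    show "\<Union> ?P = NW A X" using component_subset_NW mem_component[of _ 0] by fast
    fix C D assume "C \<in> ?P" "D \<in> ?P" "C \<noteq> D"
    then obtain u v where uv: "C = component u" "D = component v" "component u \<noteq> component v"
      by blast
    show "disjnt C D"
      using components_disjoint uv by (auto simp: disjnt_def)
  qed auto
  have irr: "irreducible_subshift A C" if "C \<in> ?P" for C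
    using that irreducible_component by auto
  show ?thesis
    unfolding irr_components_def
  proof (rule the_equality)
    show "finite ?P \<and> partition_on (NW A X) ?P \<and> (\<forall>C\<in>?P. irreducible_subshift A C)"
      by (intro conjI ballI fin part irr)
    fix P assume P: "finite P \<and> partition_on (NW A X) P \<and> (\<forall>C\<in>P. irreducible_subshift A C)"
    show "P = ?P"
      by (rule irreducible_partition_unique[OF _ _ _ fin part irr]) (use P in auto)
  qed
qed

lemma finite_irr_components: "finite (irr_components A X)"
  unfolding irr_components_eq by (rule finite_components)

lemma irr_components_disjoint:
  "C \<in> irr_components A X \<Longrightarrow> D \<in> irr_components A X \<Longrightarrow> x \<in> C \<Longrightarrow> x \<in> D \<Longrightarrow> C = D"
  unfolding irr_components_eq using components_disjoint by auto

lemma Union_irr_components: "\<Union>(irr_components A X) = NW A X"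
  unfolding irr_components_eq using component_subset_NW mem_component[of _ 0] by fast

lemma irreducible_irr_components:
  "C \<in> irr_components A X \<Longrightarrow> irreducible_subshift A C"
  unfolding irr_components_eq using irreducible_component by auto

section \<open>Limit sets\<close>

text \<open>The sign \<^term>\<open>s\<close> treats \<open>\<omega>\<close>-limits (\<^term>\<open>s = 1\<close>) and
  \<open>\<alpha>\<close>-limits (\<^term>\<open>s = -1\<close>) simultaneously.\<close>

definition limit_set :: "int \<Rightarrow> (int \<Rightarrow> 'a) \<Rightarrow> (int \<Rightarrow> 'a) set" where
  "limit_set s x = {y. \<exists>m::nat \<Rightarrow> nat. strict_mono m \<and>
     limitin (sub_top A X) (\<lambda>k. translate (s * int (m k)) x) y sequentially}"

lemma omega_limit_eq: "omega_limit A X x = limit_set 1 x"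
  by (simp add: omega_limit_def limit_set_def shift_power)

lemma alpha_limit_eq: "alpha_limit A X x = limit_set (-1) x"
  by (simp add: alpha_limit_def limit_set_def unshift_power)

text \<open>Compactness provides a limit point; an empty limit set would not single out a
  component.\<close>

lemma limit_set_nonempty:
  assumes "x \<in> X"
  shows "limit_set s x \<noteq> {}"
proof -
  obtain y m where "strict_mono m"
    "limitin (sub_top A X) ((\<lambda>k. translate (s * int k) x) \<circ> m) y sequentially"
  proof (rule closed_full_shift_sequentially_compact[OF finite_A])
    show "closedin (full_shift A) X" using sub by (simp add: subshift_def)
    show "translate (s * int k) x \<in> X" for k using assms by (simp add: translate_mem)
  qed
  then have "y \<in> limit_set s x" by (auto simp: limit_set_def o_def)
  then show ?thesis by blast
qed

text \<open>Some block occurs infinitely often along the half-orbit; since reachability is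
  transitive, all blocks after its first occurrence are linked to it.\<close>

lemma eventually_linked:
  assumes x: "x \<in> X" and s: "s = 1 \<or> s = (-1::int)"
  obtains u K where "\<And>k. k \<ge> K \<Longrightarrow> linked u (block n x (s * int k))"
proof -
  let ?w = "\<lambda>k. block n x (s * int k)"
  have "finite (range ?w)"
    by (rule finite_subset[OF _ finite_blocks]) (use x in auto)
  then obtain u where inf: "infinite (?w -` {u})"
    using inf_img_fin_dom[of ?w UNIV] by auto
  then obtain a where a: "?w a = u" using infinite_imp_nonempty by fastforce
  \<comment> \<open>Time \<open>k\<close> lies strictly between the occurrence of \<open>u\<close>
    at \<open>a\<close> and a later one at \<open>b\<close>, as the strict order in
    \<open>reach\<close> demands.\<close>
  have "linked u (?w k)" if "k \<ge> Suc a" for k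
  proof -
    obtain b where b: "b > k" "?w b = u"
      using inf unfolding infinite_nat_iff_unbounded by auto
    consider "s = 1" | "s = -1" using s by blast
    then show ?thesis
    proof cases
      case 1
      then show ?thesis
        using reachI[OF x, of "int a" "int k"] reachI[OF x, of "int k" "int b"] a b that
        by (simp add: linked_def)
    next
      \<comment> \<open>Backwards in time, larger indices lie further left, so the two occurrences
        exchange their roles.\<close>
      case 2
      then show ?thesis
        using reachI[OF x, of "- int k" "- int a"] reachI[OF x, of "- int b" "- int k"] a b that
        by (simp add: linked_def)
    qed
  qed
  then show ?thesis by (rule that)
qed

text \<open>Every block of a limit point occurs along the half-orbit of \<open>x\<close> at late
  times, where all blocks are linked to \<open>u\<close>.\<close>

lemma limit_set_subset_component:
  assumes x: "x \<in> X" and s: "s = 1 \<or> s = -1"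
  shows "\<exists>C\<in>irr_components A X. limit_set s x \<subseteq> C"
proof -
  obtain u K where K: "\<And>k. k \<ge> K \<Longrightarrow> linked u (block n x (s * int k))"
    using eventually_linked[OF assms] by blast
  have "y \<in> component u" if "y \<in> limit_set s x" for y
  proof -
    from that obtain m where m: "strict_mono m"
      "limitin (sub_top A X) (\<lambda>k. translate (s * int (m k)) x) y sequentially"
      unfolding limit_set_def by blast
    have "\<And>k. translate (s * int (m k)) x \<in> X" using x by (simp add: translate_mem)
    from limitin_sub_top_iff[OF XA this] m(2) have y: "y \<in> X"
      and lim: "\<And>N. \<forall>\<^sub>F k in sequentially. agree N y (translate (s * int (m k)) x)"
      by simp_all
    have "linked u (block n y i)" for i
    proof -
      \<comment> \<open>The margin of size \<open>|i|\<close> keeps position \<open>i\<close> of the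
        translate in the part of the half-orbit beyond time \<open>K\<close>.\<close>
      have "\<forall>\<^sub>F k in sequentially. k \<ge> K + nat \<bar>i\<bar>" by (rule eventually_ge_at_top)
      with lim[of "nat \<bar>i\<bar> + n"]
      have "\<forall>\<^sub>F k in sequentially. agree (nat \<bar>i\<bar> + n) y (translate (s * int (m k)) x)
        \<and> k \<ge> K + nat \<bar>i\<bar>" by eventually_elim auto
      then obtain k where k: "agree (nat \<bar>i\<bar> + n) y (translate (s * int (m k)) x)"
        "k \<ge> K + nat \<bar>i\<bar>" by (auto dest: eventually_happens)
      have "m k \<ge> k" using m(1) by (rule seq_suble)
      with k(2) have mk: "int (m k) \<ge> int K + \<bar>i\<bar>" by simp
      have "block n y i = block n (translate (s * int (m k)) x) i"
        using k(1) by (auto simp: block_eq_iff agree_def simp del: block_translate)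
      \<comment> \<open>Since \<open>s * s = 1\<close>, the position \<open>i + s * m k\<close>
        equals \<open>s * (m k + s * i)\<close>, and the second factor is non-negative by
        \<open>mk\<close>.\<close>
      also have "\<dots> = block n x (s * int (nat (int (m k) + s * i)))"
        using s mk by (auto simp: algebra_simps)
      finally have "block n y i = block n x (s * int (nat (int (m k) + s * i)))" .
      moreover have "nat (int (m k) + s * i) \<ge> K" using s mk by auto
      ultimately show ?thesis using K by metis
    qed
    then show ?thesis using y by (simp add: component_def)
  qed
  then have "limit_set s x \<subseteq> component u" by blast
  moreover have "component u \<in> irr_components A X"
    using calculation limit_set_nonempty[OF x, of s] by (auto simp: irr_components_eq)
  ultimately show ?thesis by blast
qed

lemma limit_component:
  assumes "x \<in> X" and "s = 1 \<or> s = -1"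
  shows "\<exists>!C. C \<in> irr_components A X \<and> limit_set s x \<subseteq> C"
proof (rule ex_ex1I)
  show "\<exists>C. C \<in> irr_components A X \<and> limit_set s x \<subseteq> C"
    using limit_set_subset_component[OF assms] by blast
  obtain y where y: "y \<in> limit_set s x" using limit_set_nonempty[OF assms(1)] by blast
  fix C D
  assume "C \<in> irr_components A X \<and> limit_set s x \<subseteq> C"
    "D \<in> irr_components A X \<and> limit_set s x \<subseteq> D"
  then show "C = D" using irr_components_disjoint[of C D y] y by auto
qed

lemma C_omega:
  assumes "x \<in> X"
  shows "C_omega A X x \<in> irr_components A X" "limit_set 1 x \<subseteq> C_omega A X x"
proof -
  have "\<exists>!C. C \<in> irr_components A X \<and> limit_set 1 x \<subseteq> C"
    by (rule limit_component[OF assms]) simp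
  from theI'[OF this] show "C_omega A X x \<in> irr_components A X" "limit_set 1 x \<subseteq> C_omega A X x"
    unfolding C_omega_def omega_limit_eq by blast+
qed

lemma C_alpha:
  assumes "x \<in> X"
  shows "C_alpha A X x \<in> irr_components A X" "limit_set (-1) x \<subseteq> C_alpha A X x"
proof -
  have "\<exists>!C. C \<in> irr_components A X \<and> limit_set (-1) x \<subseteq> C"
    by (rule limit_component[OF assms]) simp
  from theI'[OF this] show "C_alpha A X x \<in> irr_components A X" "limit_set (-1) x \<subseteq> C_alpha A X x"
    unfolding C_alpha_def alpha_limit_eq by blast+
qed

section \<open>Endomorphisms\<close>

lemma endomorphism_mem: "endomorphism A X \<tau> \<Longrightarrow> x \<in> X \<Longrightarrow> \<tau> x \<in> X"
  by (auto simp: endomorphism_def)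

lemma endomorphism_translate:
  assumes \<tau>: "endomorphism A X \<tau>" and "x \<in> X"
  shows "\<tau> (translate p x) = translate p (\<tau> x)"
proof -
  have c: "\<tau> (translate 1 x) = translate 1 (\<tau> x)" if "x \<in> X" for x
    using \<tau> that by (simp add: endomorphism_def shift_eq_translate)
  show ?thesis
  proof (induction p rule: int_induct[where k = 0])
    case (step1 i)
    then show ?case using c[of "translate i x"] assms(2) by (simp add: translate_mem add.commute)
  next
    case (step2 i)
    \<comment> \<open>The downward step moves up once, where equivariance is known, and then cancels
      the shift.\<close>
    have "translate 1 (\<tau> (translate (i - 1) x)) = \<tau> (translate i x)"
      using c[of "translate (i - 1) x"] assms(2) by (simp add: translate_mem)
    then have "translate (-1) (translate 1 (\<tau> (translate (i - 1) x))) = translate (i - 1) (\<tau> x)"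
      using step2 by simp
    then show ?case by simp
  qed simp
qed

text \<open>The preimage of a neighbourhood of \<open>\<tau> x\<close> is a neighbourhood of
  \<open>x\<close>, and \<open>\<tau>\<close> carries a return there to a return at
  \<open>\<tau> x\<close>.\<close>

lemma endomorphism_NW:
  assumes \<tau>: "endomorphism A X \<tau>" and x: "x \<in> NW A X"
  shows "\<tau> x \<in> NW A X"
proof -
  have xX: "x \<in> X" using x by (simp add: NW_def)
  have "\<exists>m\<ge>1. U \<inter> (shift ^^ m) ` U \<noteq> {}" if U: "neighborhood (sub_top A X) (\<tau> x) U" for U
  proof -
    from U obtain V where V: "openin (sub_top A X) V" "\<tau> x \<in> V" "V \<subseteq> U"
      by (auto simp: neighborhood_def)
    let ?V = "{y \<in> topspace (sub_top A X). \<tau> y \<in> V}"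
    have "openin (sub_top A X) ?V"
      using \<tau> V(1) openin_continuous_map_preimage unfolding endomorphism_def by blast
    moreover have "x \<in> ?V" using xX XA V(2) by auto
    ultimately have "neighborhood (sub_top A X) x ?V"
      unfolding neighborhood_def by blast
    with x obtain m z where m: "m \<ge> 1" and z: "z \<in> ?V" "translate (int m) z \<in> ?V"
      by (rule NW_E)
    have "translate (int m) (\<tau> z) \<in> U" "\<tau> z \<in> U"
      using z V(3) endomorphism_translate[OF \<tau>, of z "int m"] by auto
    then show ?thesis using m by (auto simp: shift_power intro!: exI[of _ m])
  qed
  then show ?thesis using endomorphism_mem[OF \<tau> xX] by (simp add: NW_def)
qed

text \<open>The preimages of the components are closed and invariant in \<open>X\<close>, and they
  cover \<open>C\<close> because \<open>\<tau>\<close> preserves non-wandering points;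
  irreducibility of \<open>C\<close> selects one of them.\<close>

lemma endomorphism_component:
  assumes \<tau>: "endomorphism A X \<tau>" and C: "C \<in> irr_components A X"
  shows "\<exists>D\<in>irr_components A X. \<tau> ` C \<subseteq> D"
proof -
  have CX: "C \<subseteq> X" using C Union_irr_components by (auto simp: NW_def)
  have "\<exists>D\<in>irr_components A X. C \<subseteq> {x \<in> X. \<tau> x \<in> D}"
  proof (rule irreducible_subset_of_finite_cover[OF irreducible_irr_components[OF C]
        finite_irr_components])
    show "C \<subseteq> (\<Union>D\<in>irr_components A X. {x \<in> X. \<tau> x \<in> D})"
    proof
      fix x assume x: "x \<in> C"
      then have "x \<in> NW A X" using C Union_irr_components by blast
      then have "\<tau> x \<in> \<Union>(irr_components A X)"
        using endomorphism_NW[OF \<tau>] Union_irr_components by blast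
      then show "x \<in> (\<Union>D\<in>irr_components A X. {x \<in> X. \<tau> x \<in> D})" using x CX by blast
    qed
    fix D assume D: "D \<in> irr_components A X"
    then have subD: "subshift A D"
      using irreducible_irr_components by (simp add: irreducible_subshift_def)
    have "D \<subseteq> X" using D Union_irr_components by (auto simp: NW_def)
    then have "closedin (sub_top A X) D"
      using subD by (simp add: subshift_def closedin_closed_subtopology closedin_subset_topspace)
    then have "closedin (sub_top A X) {x \<in> topspace (sub_top A X). \<tau> x \<in> D}"
      using \<tau> closedin_continuous_map_preimage unfolding endomorphism_def by blast
    then have "closedin (sub_top A X) {x \<in> X. \<tau> x \<in> D}"
      using XA by (simp add: Int_absorb1)
    then have "closedin (subtopology (sub_top A X) C) (C \<inter> {x \<in> X. \<tau> x \<in> D})"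
      by (rule closedin_subtopology_Int_closed)
    then show "closedin (sub_top A C) (C \<inter> {x \<in> X. \<tau> x \<in> D})"
      using CX by (simp add: subtopology_subtopology Int_absorb1)
    show "x \<in> {x \<in> X. \<tau> x \<in> D}" if "x \<in> C" "translate p x \<in> {x \<in> X. \<tau> x \<in> D}" for x p
      using that CX endomorphism_translate[OF \<tau>, of x p] subshift_translate_iff[OF subD] by auto
  qed
  then show ?thesis by blast
qed

section \<open>The induced map on components\<close>

lemma induced_mapD:
  assumes "induced_map A X \<tau> \<rho>" and "C \<in> irr_components A X"
  shows "\<rho> C \<in> irr_components A X" and "x \<in> C \<Longrightarrow> \<tau> x \<in> \<rho> C"
  using assms unfolding induced_map_def by blast+

text \<open>The image of a single point of \<open>C\<close> determines the value at
  \<open>C\<close>, as components are non-empty and disjoint.\<close>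

lemma induced_map_unique:
  assumes "induced_map A X \<tau> \<rho>" and "induced_map A X \<tau> \<rho>'"
  shows "\<rho> = \<rho>'"
proof (rule PiE_ext)
  show "\<rho> \<in> irr_components A X \<rightarrow>\<^sub>E irr_components A X"
    "\<rho>' \<in> irr_components A X \<rightarrow>\<^sub>E irr_components A X"
    using assms by (auto simp: induced_map_def)
  fix C assume C: "C \<in> irr_components A X"
  then obtain x where "x \<in> C"
    using irreducible_irr_components by (force simp: irreducible_subshift_def)
  then show "\<rho> C = \<rho>' C"
    using irr_components_disjoint induced_mapD[OF assms(1) C] induced_mapD[OF assms(2) C] by metis
qed

lemma ex1_induced_map:
  assumes \<tau>: "endomorphism A X \<tau>"
  shows "\<exists>!\<rho>. induced_map A X \<tau> \<rho>"
proof -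
  obtain f where f: "\<And>C. C \<in> irr_components A X \<Longrightarrow> f C \<in> irr_components A X \<and> \<tau> ` C \<subseteq> f C"
    using endomorphism_component[OF \<tau>] by metis
  have "induced_map A X \<tau> (restrict f (irr_components A X))"
    unfolding induced_map_def using f by auto
  then show ?thesis using induced_map_unique by blast
qed

lemma induced_map_rho: "endomorphism A X \<tau> \<Longrightarrow> induced_map A X \<tau> (rho A X \<tau>)"
  unfolding rho_def by (rule theI'[OF ex1_induced_map])

lemma rho_eqI: "endomorphism A X \<tau> \<Longrightarrow> induced_map A X \<tau> \<rho> \<Longrightarrow> rho A X \<tau> = \<rho>"
  using induced_map_unique[OF induced_map_rho] .

lemma endomorphism_limit_set:
  assumes \<tau>: "endomorphism A X \<tau>" and x: "x \<in> X" and y: "y \<in> limit_set s x"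
  shows "\<tau> y \<in> limit_set s (\<tau> x)"
proof -
  from y obtain m where m: "strict_mono m"
    "limitin (sub_top A X) (\<lambda>k. translate (s * int (m k)) x) y sequentially"
    unfolding limit_set_def by blast
  have "continuous_map (sub_top A X) (sub_top A X) \<tau>" using \<tau> by (simp add: endomorphism_def)
  from continuous_map_limit[OF this m(2)]
  have "limitin (sub_top A X) (\<lambda>k. translate (s * int (m k)) (\<tau> x)) (\<tau> y) sequentially"
    by (simp add: o_def endomorphism_translate[OF \<tau> x])
  then show ?thesis using m(1) unfolding limit_set_def by blast
qed

text \<open>The image of one limit point lies in both \<open>rho A X \<tau> C\<close> and
  \<open>D\<close>, which therefore coincide; \<open>s\<close> covers both time directions.\<close>

lemma rho_limit_component:
  assumes \<tau>: "endomorphism A X \<tau>" and x: "x \<in> X"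
    and C: "C \<in> irr_components A X" "limit_set s x \<subseteq> C"
    and D: "D \<in> irr_components A X" "limit_set s (\<tau> x) \<subseteq> D"
  shows "rho A X \<tau> C = D"
proof -
  obtain y where y: "y \<in> limit_set s x" using limit_set_nonempty[OF x] by blast
  have "\<tau> y \<in> D" using endomorphism_limit_set[OF \<tau> x y] D by blast
  moreover have "\<tau> y \<in> rho A X \<tau> C" "rho A X \<tau> C \<in> irr_components A X"
    using induced_mapD[OF induced_map_rho[OF \<tau>] C(1)] y C(2) by auto
  ultimately show ?thesis using D irr_components_disjoint by blast
qed

lemma rho_C_alpha:
  assumes \<tau>: "endomorphism A X \<tau>" and x: "x \<in> X"
  shows "rho A X \<tau> (C_alpha A X x) = C_alpha A X (\<tau> x)"
  by (rule rho_limit_component[OF \<tau> x C_alpha[OF x] C_alpha[OF endomorphism_mem[OF \<tau> x]]])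

lemma rho_C_omega:
  assumes \<tau>: "endomorphism A X \<tau>" and x: "x \<in> X"
  shows "rho A X \<tau> (C_omega A X x) = C_omega A X (\<tau> x)"
  by (rule rho_limit_component[OF \<tau> x C_omega[OF x] C_omega[OF endomorphism_mem[OF \<tau> x]]])

lemma poset_endomorphism_rho:
  assumes \<tau>: "endomorphism A X \<tau>"
  shows "poset_endomorphism (irr_components A X) (comp_le A X) (rho A X \<tau>)"
  unfolding poset_endomorphism_def
proof
  show "rho A X \<tau> \<in> irr_components A X \<rightarrow>\<^sub>E irr_components A X"
    using induced_map_rho[OF \<tau>] by (simp add: induced_map_def)
  show "monotone_on (irr_components A X) (comp_le A X) (comp_le A X) (rho A X \<tau>)"
  proof (rule monotone_onI)
    fix C D assume "comp_le A X C D"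
    then obtain x where "x \<in> X" "C_alpha A X x = C" "C_omega A X x = D"
      by (auto simp: comp_le_def)
    \<comment> \<open>If \<open>x\<close> witnesses the relation between \<open>C\<close> and
      \<open>D\<close>, then \<open>\<tau> x\<close> witnesses it between their images.\<close>
    then show "comp_le A X (rho A X \<tau> C) (rho A X \<tau> D)"
      using rho_C_alpha[OF \<tau>] rho_C_omega[OF \<tau>] endomorphism_mem[OF \<tau>]
      unfolding comp_le_def by metis
  qed
qed

section \<open>The two endomorphism monoids\<close>

lemma endomorphism_compose:
  assumes "endomorphism A X \<tau>" and "endomorphism A X \<tau>'"
  shows "endomorphism A X (compose X \<tau> \<tau>')"
  unfolding endomorphism_def
proof (intro conjI ballI)
  show "compose X \<tau> \<tau>' \<in> X \<rightarrow>\<^sub>E X"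
    using assms by (auto simp: compose_def endomorphism_mem)
  have "continuous_map (sub_top A X) (sub_top A X) (\<tau> \<circ> \<tau>')"
    using assms by (auto simp: endomorphism_def intro: continuous_map_compose)
  then show "continuous_map (sub_top A X) (sub_top A X) (compose X \<tau> \<tau>')"
    \<comment> \<open>\<open>compose X\<close> can differ from the ordinary composite only outside
      \<open>X\<close>.\<close>
    by (rule continuous_map_eq) (auto simp: compose_def)
  fix x assume x: "x \<in> X"
  then have "shift x \<in> X" by (simp add: shift_eq_translate translate_mem)
  then show "compose X \<tau> \<tau>' (shift x) = shift (compose X \<tau> \<tau>' x)"
    using x assms endomorphism_mem[OF assms(2) x] by (simp add: compose_def endomorphism_def)
qed

lemma endomorphism_id: "endomorphism A X (restrict id X)"
  unfolding endomorphism_def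
proof (intro conjI ballI)
  show "continuous_map (sub_top A X) (sub_top A X) (restrict id X)"
    by (rule continuous_map_eq[OF continuous_map_id]) auto
  fix x assume x: "x \<in> X"
  then have "shift x \<in> X" by (simp add: shift_eq_translate translate_mem)
  then show "restrict id X (shift x) = shift (restrict id X x)" using x by simp
qed auto

lemma monoid_End_shift: "monoid (End_shift A X)"
proof (rule monoidI)
  fix f g h assume "f \<in> carrier (End_shift A X)" "g \<in> carrier (End_shift A X)"
    "h \<in> carrier (End_shift A X)"
  then show "f \<otimes>\<^bsub>End_shift A X\<^esub> g \<otimes>\<^bsub>End_shift A X\<^esub> h
      = f \<otimes>\<^bsub>End_shift A X\<^esub> (g \<otimes>\<^bsub>End_shift A X\<^esub> h)"
    by (auto simp: End_shift_def compose_def endomorphism_mem fun_eq_iff)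
next
  fix f assume "f \<in> carrier (End_shift A X)"
  then have f: "f \<in> X \<rightarrow>\<^sub>E X" by (simp add: End_shift_def endomorphism_def)
  show "\<one>\<^bsub>End_shift A X\<^esub> \<otimes>\<^bsub>End_shift A X\<^esub> f = f"
    "f \<otimes>\<^bsub>End_shift A X\<^esub> \<one>\<^bsub>End_shift A X\<^esub> = f"
    using f by (auto simp: End_shift_def compose_def fun_eq_iff PiE_def extensional_def)
qed (auto simp: End_shift_def endomorphism_compose endomorphism_id)

end

lemma monoid_End_poset: "monoid (End_poset P R)"
proof (rule monoidI)
  fix f g h assume "f \<in> carrier (End_poset P R)" "g \<in> carrier (End_poset P R)"
    "h \<in> carrier (End_poset P R)"
  then have "f \<in> P \<rightarrow>\<^sub>E P" "g \<in> P \<rightarrow>\<^sub>E P" "h \<in> P \<rightarrow>\<^sub>E P"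
    by (auto simp: End_poset_def poset_endomorphism_def)
  then show "f \<otimes>\<^bsub>End_poset P R\<^esub> g \<otimes>\<^bsub>End_poset P R\<^esub> h
      = f \<otimes>\<^bsub>End_poset P R\<^esub> (g \<otimes>\<^bsub>End_poset P R\<^esub> h)"
    by (auto simp: End_poset_def compose_def fun_eq_iff)
next
  fix f assume "f \<in> carrier (End_poset P R)"
  then have f: "f \<in> P \<rightarrow>\<^sub>E P" by (simp add: End_poset_def poset_endomorphism_def)
  show "\<one>\<^bsub>End_poset P R\<^esub> \<otimes>\<^bsub>End_poset P R\<^esub> f = f"
    "f \<otimes>\<^bsub>End_poset P R\<^esub> \<one>\<^bsub>End_poset P R\<^esub> = f"
    using f by (auto simp: End_poset_def compose_def fun_eq_iff PiE_def extensional_def)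
next
  fix f g assume "f \<in> carrier (End_poset P R)" "g \<in> carrier (End_poset P R)"
  then have f: "f \<in> P \<rightarrow>\<^sub>E P" "monotone_on P R R f" and g: "g \<in> P \<rightarrow>\<^sub>E P" "monotone_on P R R g"
    by (auto simp: End_poset_def poset_endomorphism_def)
  have "monotone_on P R R (compose P f g)"
  proof (rule monotone_onI)
    fix a b assume "a \<in> P" "b \<in> P" "R a b"
    moreover from this have "R (g a) (g b)" using g(2) by (simp add: monotone_onD)
    moreover have "g a \<in> P" "g b \<in> P" using calculation g(1) by auto
    ultimately show "R (compose P f g a) (compose P f g b)"
      using f(2) by (simp add: compose_def monotone_onD)
  qed
  moreover have "compose P f g \<in> P \<rightarrow>\<^sub>E P" using f g by (auto simp: compose_def)
  ultimately show "f \<otimes>\<^bsub>End_poset P R\<^esub> g \<in> carrier (End_poset P R)"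
    by (simp add: End_poset_def poset_endomorphism_def)
next
  show "\<one>\<^bsub>End_poset P R\<^esub> \<in> carrier (End_poset P R)"
    by (auto simp: End_poset_def poset_endomorphism_def intro!: monotone_onI)
qed

section \<open>Compatibility of the induced map with composition and identity\<close>

context glued_subshift
begin

text \<open>By uniqueness it suffices that the composite of the two induced maps sends each
  \<open>C\<close> to a component containing the image of \<open>C\<close> under the
  composite.\<close>

lemma rho_compose:
  assumes \<tau>: "endomorphism A X \<tau>" and \<tau>': "endomorphism A X \<tau>'"
  shows "rho A X (compose X \<tau> \<tau>') = compose (irr_components A X) (rho A X \<tau>) (rho A X \<tau>')"
proof (rule rho_eqI[OF endomorphism_compose[OF \<tau> \<tau>']])
  have CX: "C \<subseteq> X" if "C \<in> irr_components A X" for C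
    using that Union_irr_components by (auto simp: NW_def)
  have r: "rho A X f \<in> irr_components A X \<rightarrow>\<^sub>E irr_components A X"
    "\<And>C x. C \<in> irr_components A X \<Longrightarrow> x \<in> C \<Longrightarrow> f x \<in> rho A X f C" if "endomorphism A X f" for f
    using induced_map_rho[OF that] induced_mapD(2)[OF induced_map_rho[OF that]]
    by (simp_all add: induced_map_def)
  show "induced_map A X (compose X \<tau> \<tau>')
     (compose (irr_components A X) (rho A X \<tau>) (rho A X \<tau>'))"
    unfolding induced_map_def
  proof (intro conjI ballI)
    show "compose (irr_components A X) (rho A X \<tau>) (rho A X \<tau>')
      \<in> irr_components A X \<rightarrow>\<^sub>E irr_components A X"
      using r(1)[OF \<tau>] r(1)[OF \<tau>'] by (auto simp: compose_def)
    fix C assume C: "C \<in> irr_components A X"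
    then have "rho A X \<tau>' C \<in> irr_components A X" using r(1)[OF \<tau>'] by auto
    then show "compose X \<tau> \<tau>' ` C \<subseteq> compose (irr_components A X) (rho A X \<tau>) (rho A X \<tau>') C"
      using C CX[OF C] r(2)[OF \<tau>'] r(2)[OF \<tau>] by (auto simp: compose_def)
  qed
qed

lemma rho_id: "rho A X (restrict id X) = restrict id (irr_components A X)"
proof (rule rho_eqI[OF endomorphism_id])
  have "C \<subseteq> X" if "C \<in> irr_components A X" for C
    using that Union_irr_components by (auto simp: NW_def)
  then show "induced_map A X (restrict id X) (restrict id (irr_components A X))"
    by (auto simp: induced_map_def)
qed

lemma monoid_morphism_rho:
  "monoid_morphism (End_shift A X) (End_poset (irr_components A X) (comp_le A X)) (rho A X)"
  unfolding monoid_morphism_def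
proof (intro conjI monoid_End_shift monoid_End_poset homI)
  show "rho A X \<one>\<^bsub>End_shift A X\<^esub> = \<one>\<^bsub>End_poset (irr_components A X) (comp_le A X)\<^esub>"
    by (simp add: End_shift_def End_poset_def rho_id)
qed (simp_all add: End_shift_def End_poset_def rho_compose poset_endomorphism_rho)

end

theorem proposition3p14:
  fixes A :: "'a set" and X :: "(int \<Rightarrow> 'a) set"
  assumes "finite A" and "subshift_of_finite_type A X"
  shows "(\<forall>\<tau>. endomorphism A X \<tau> \<longrightarrow>
            (\<exists>!\<rho>. induced_map A X \<tau> \<rho>) \<and>
            (\<forall>x\<in>X. rho A X \<tau> (C_alpha A X x) = C_alpha A X (\<tau> x) \<and>
                    rho A X \<tau> (C_omega A X x) = C_omega A X (\<tau> x)) \<and>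
            poset_endomorphism (irr_components A X) (comp_le A X) (rho A X \<tau>)) \<and>
         monoid_morphism (End_shift A X) (End_poset (irr_components A X) (comp_le A X)) (rho A X)"
proof -
  obtain n where "glued_subshift A X n"
    using finite_type_glued_subshift[OF assms] .
  then interpret glued_subshift A X n .
  show ?thesis
    using ex1_induced_map rho_C_alpha rho_C_omega poset_endomorphism_rho monoid_morphism_rho
    by blast
qed

end
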